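(* Let $P$ be a nilpotent linear operator on a finite-dimensional real or complex symplectic vector space $(V, B)$, self-adjoint with respect to $B$, and suppose that $(V, B, P)$ is a direct sum of Jordan blocks all of the same height $k$. Then the subspaces of $V$ invariant under $\mathrm{Aut}(V, B, P)$ are exactly the subspaces $\operatorname{Ker} P^i = \operatorname{Im} P^{k-i}$, $0 \le i \le k$.
   Context: $P$ self-adjoint with respect to $B$ means $B(Pu,v) = B(u,Pv)$. $\mathrm{Aut}(V,B,P)$ is the group of linear automorphisms of $V$ preserving $B$ and commuting with $P$. A Jordan block of height $k$ (with eigenvalue $0$) is a $2k$-dimensional $B$-orthogonal summand with a basis in which $B = \begin{pmatrix} 0 & E_k \\ -E_k & 0\end{pmatrix}$ and the form $A(u,v) = B(Pu,v)$ has matrix $\begin{pmatrix} 0 & J_k(0) \\ -J_k(0)^T & 0\end{pmatrix}$, where $J_k(0)$ is the nilpotent $k\times k$ Jordan cell; on such a block $P$ acts as two nilpotent Jordan cells of size $k$. "$(V,B,P)$ is a direct sum of such blocks" means $V$ decomposes into a $B$-orthogonal, $P$-invariant direct sum of such blocks. *)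

theory Defs
  imports "HOL-Analysis.Analysis"
begin

text \<open>The space V is modelled as 'k^'n (finite-dimensional over the field 'k),
  subspaces / spans / independence are those of the vector space vec over 'k
  (scalar multiplication (*s)), bilinear forms are functions V => V => 'k.\<close>

definition bilinear_form :: "('k::field^'n \<Rightarrow> 'k^'n \<Rightarrow> 'k) \<Rightarrow> bool" where
  "bilinear_form B \<longleftrightarrow>
     (\<forall>u. Vector_Spaces.linear (*s) (*) (\<lambda>v. B u v)) \<and>
     (\<forall>v. Vector_Spaces.linear (*s) (*) (\<lambda>u. B u v))"

text \<open>Symplectic form: nondegenerate skew-symmetric bilinear form.\<close>
definition symplectic_form :: "('k::field^'n \<Rightarrow> 'k^'n \<Rightarrow> 'k) \<Rightarrow> bool" where
  "symplectic_form B \<longleftrightarrow> bilinear_form B \<and>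
     (\<forall>u v. B u v = - B v u) \<and>
     (\<forall>u. (\<forall>v. B u v = 0) \<longrightarrow> u = 0)"

definition lin_op :: "('k::field^'n \<Rightarrow> 'k^'n) \<Rightarrow> bool" where
  "lin_op P \<longleftrightarrow> Vector_Spaces.linear (*s) (*s) P"

definition nilpotent_op :: "('k::field^'n \<Rightarrow> 'k^'n) \<Rightarrow> bool" where
  "nilpotent_op P \<longleftrightarrow> (\<exists>m. P ^^ m = (\<lambda>_. 0))"

definition self_adjoint :: "('k::field^'n \<Rightarrow> 'k^'n \<Rightarrow> 'k) \<Rightarrow> ('k^'n \<Rightarrow> 'k^'n) \<Rightarrow> bool" where
  "self_adjoint B P \<longleftrightarrow> (\<forall>u v. B (P u) v = B u (P v))"

text \<open>Aut(V,B,P): linear automorphisms preserving B and commuting with P.\<close>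
definition Aut :: "('k::field^'n \<Rightarrow> 'k^'n \<Rightarrow> 'k) \<Rightarrow> ('k^'n \<Rightarrow> 'k^'n) \<Rightarrow> ('k^'n \<Rightarrow> 'k^'n) set" where
  "Aut B P = {g. Vector_Spaces.linear (*s) (*s) g \<and> bij g \<and>
               (\<forall>u v. B (g u) (g v) = B u v) \<and> (\<forall>u. g (P u) = P (g u))}"

text \<open>Matrix entries (indices 0..2k-1) of the standard block forms:
  B = [[0, E_k], [-E_k, 0]],  A = [[0, J_k(0)], [-J_k(0)^T, 0]],
  where J_k(0) is the nilpotent Jordan cell (ones on the superdiagonal).\<close>
definition Jcell :: "nat \<Rightarrow> nat \<Rightarrow> 'k::field" where
  "Jcell a b = (if b = a + 1 then 1 else 0)"

definition Bstd :: "nat \<Rightarrow> nat \<Rightarrow> nat \<Rightarrow> 'k::field" where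
  "Bstd k i l = (if i < k \<and> k \<le> l then (if l - k = i then 1 else 0)
                 else if k \<le> i \<and> l < k then (if i - k = l then -1 else 0)
                 else 0)"

definition Astd :: "nat \<Rightarrow> nat \<Rightarrow> nat \<Rightarrow> 'k::field" where
  "Astd k i l = (if i < k \<and> k \<le> l then Jcell i (l - k)
                 else if k \<le> i \<and> l < k then - Jcell l (i - k)
                 else 0)"

text \<open>(V,B,P) is a B-orthogonal, P-invariant direct sum of m Jordan blocks of height k:
  x j i (j < m, i < 2k) is a basis of V; block j is span {x j i | i < 2k};
  in the basis x j 0, ..., x j (2k-1) of block j the forms B and A(u,v) = B(P u, v)
  have the standard matrices Bstd k and Astd k.\<close>
definition jordan_blocks_same_height ::
  "('k::field^'n \<Rightarrow> 'k^'n \<Rightarrow> 'k) \<Rightarrow> ('k^'n \<Rightarrow> 'k^'n) \<Rightarrow> nat \<Rightarrow> bool" where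
  "jordan_blocks_same_height B P k \<longleftrightarrow>
    (\<exists>(m::nat) (x :: nat \<Rightarrow> nat \<Rightarrow> 'k^'n).
       inj_on (\<lambda>(j, i). x j i) ({..<m} \<times> {..<2*k}) \<and>
       vec.independent ((\<lambda>(j, i). x j i) ` ({..<m} \<times> {..<2*k})) \<and>
       vec.span ((\<lambda>(j, i). x j i) ` ({..<m} \<times> {..<2*k})) = UNIV \<and>
       (\<forall>j<m. P ` vec.span (x j ` {..<2*k}) \<subseteq> vec.span (x j ` {..<2*k})) \<and>
       (\<forall>j<m. \<forall>j'<m. j \<noteq> j' \<longrightarrow>
          (\<forall>u\<in>vec.span (x j ` {..<2*k}). \<forall>v\<in>vec.span (x j' ` {..<2*k}). B u v = 0)) \<and>
       (\<forall>j<m. \<forall>i<2*k. \<forall>l<2*k. B (x j i) (x j l) = Bstd k i l \<and>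
                              B (P (x j i)) (x j l) = Astd k i l))"

text \<open>W is a subspace invariant under every element of Aut(V,B,P).\<close>
definition aut_invariant :: "('k::field^'n \<Rightarrow> 'k^'n \<Rightarrow> 'k) \<Rightarrow> ('k^'n \<Rightarrow> 'k^'n) \<Rightarrow> ('k^'n) set \<Rightarrow> bool" where
  "aut_invariant B P W \<longleftrightarrow> vec.subspace W \<and> (\<forall>g\<in>Aut B P. g ` W \<subseteq> W)"

end

theory Submission
  imports Defs
begin

(*
  Let G_{a,b} v = sum_{r<k} B(P^(k-1-r) a, v) P^r b (transvection_map a b) and G_a = G_{a,a}.
  Since P is B-self-adjoint and B is alternating, the P-orbit of a is B-isotropic; hence G_a
  commutes with P, is B-skew and squares to zero, so id + c G_a lies in Aut(V,B,P). An Aut-invariant subspace W is therefore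
  stable under every G_a and, by polarisation, under G_{a,b} + G_{b,a}. Let i be least with
  W inside Ker P^i, pick w in W with P^(i-1) w <> 0 and z with B(z, P^(i-1) w) <> 0. Evaluating
  G_{a,b} + G_{b,a} at w with a = P^(i-1-d) z, every term except those of P-degree k-1-d lies
  in Im P^(k-d); this shows Im P^(k-d) <= W inductively up to d = i. Finally Ker P^i = Im P^(k-i)
  is read off the Jordan basis via the B-dual expansion of a vector in that basis.
*)

lemma funpow_le_apply:
  assumes "m \<le> n"
  shows "(f ^^ n) x = (f ^^ m) ((f ^^ (n - m)) x)" and "(f ^^ n) x = (f ^^ (n - m)) ((f ^^ m) x)"
proof -
  have "n = m + (n - m)" "n = (n - m) + m" using assms by simp_all
  then show "(f ^^ n) x = (f ^^ m) ((f ^^ (n - m)) x)" and "(f ^^ n) x = (f ^^ (n - m)) ((f ^^ m) x)"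
    by (metis comp_apply funpow_add)+
qed

lemma funpow_in_range_subset:
  fixes f :: "'a \<Rightarrow> 'a"
  shows "range (f ^^ n) \<subseteq> W \<Longrightarrow> n \<le> r \<Longrightarrow> (f ^^ r) y \<in> W"
  using funpow_le_apply(1)[of n r f y] by blast

lemma funpow_commute: "(\<And>y. g (f y) = f (g y)) \<Longrightarrow> (f ^^ n) (g x) = g ((f ^^ n) x)"
  by (induction n) auto

lemma subspace_scale_cancel:
  fixes W :: "('k::field^'n) set"
  assumes "vec.subspace W" "c \<noteq> 0" "c *s x \<in> W"
  shows "x \<in> W"
  using vec.subspace_scale[OF assms(1,3), of "inverse c"] assms(2) by simp

lemma sum_minus_term_in_subspace:
  fixes W :: "('k::field^'n) set" and k r0 :: nat
  assumes W: "vec.subspace W" and "r0 < k"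
    and below: "\<And>r. r < r0 \<Longrightarrow> f r = 0" and above: "\<And>r. r0 < r \<Longrightarrow> r < k \<Longrightarrow> g r \<in> W"
  shows "(\<Sum>r<k. f r *s g r) - f r0 *s g r0 \<in> W"
proof -
  have "(\<Sum>r<k. f r *s g r) - f r0 *s g r0 = (\<Sum>r\<in>{..<k} - {r0}. f r *s g r)"
    using \<open>r0 < k\<close> by (subst sum_diff1) auto
  also have "\<dots> \<in> W"
  proof (rule vec.subspace_sum[OF W])
    fix r assume "r \<in> {..<k} - {r0}"
    then consider "r < r0" | "r0 < r" "r < k" by fastforce
    then show "f r *s g r \<in> W"
      by cases (simp_all add: below vec.subspace_0[OF W] vec.subspace_scale[OF W above])
  qed
  finally show ?thesis .
qed

locale symplectic_self_adjoint =
  fixes B :: "'k::field_char_0^'n \<Rightarrow> 'k^'n \<Rightarrow> 'k" and P :: "'k^'n \<Rightarrow> 'k^'n"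
  assumes symplectic: "symplectic_form B" and lin_P: "lin_op P" and adjoint: "self_adjoint B P"
begin

lemma module_hom_B_right: "module_hom (*s) (*) (B u)"
  using symplectic unfolding symplectic_form_def bilinear_form_def Vector_Spaces.linear_iff_module_hom
  by (elim conjE) (erule allE[of _ u])

lemma module_hom_B_left: "module_hom (*s) (*) (\<lambda>u. B u v)"
  using symplectic unfolding symplectic_form_def bilinear_form_def Vector_Spaces.linear_iff_module_hom
  by (elim conjE) (erule allE[of _ v])

lemmas B_add_right = module_hom.add[OF module_hom_B_right]
  and B_add_left = module_hom.add[OF module_hom_B_left]
  and B_diff_left = module_hom.diff[OF module_hom_B_left]
  and B_scale_right = module_hom.scale[OF module_hom_B_right]
  and B_scale_left = module_hom.scale[OF module_hom_B_left]
  and B_sum_right = module_hom.sum[OF module_hom_B_right]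
  and B_sum_left = module_hom.sum[OF module_hom_B_left]
  and B_zero_right = module_hom.zero[OF module_hom_B_right]
  and B_zero_left = module_hom.zero[OF module_hom_B_left]

lemma B_skew: "B u v = - B v u"
  using symplectic unfolding symplectic_form_def by blast

lemma B_nondegenerate: "(\<And>v. B u v = 0) \<Longrightarrow> u = 0"
  using symplectic unfolding symplectic_form_def by blast

lemma linear_P: "Vector_Spaces.linear (*s) (*s) P"
  using lin_P by (simp add: lin_op_def)

lemma linear_funpow: "Vector_Spaces.linear (*s) (*s) (P ^^ n)"
proof (induction n)
  case 0
  then show ?case using vec.linear_id by (simp add: id_def)
next
  case (Suc n)
  then show ?case using Vector_Spaces.linear_compose[OF Suc linear_P] by (simp add: comp_def)
qed

lemma funpow_eq_0_mono: "(P ^^ i) w = 0 \<Longrightarrow> i \<le> r \<Longrightarrow> (P ^^ r) w = 0"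
  using funpow_le_apply(2)[of i r P w] by (simp add: vec.linear_0[OF linear_funpow])

lemma B_adjoint: "B (P u) v = B u (P v)"
  using adjoint by (simp add: self_adjoint_def)

lemma B_adjoint_funpow: "B ((P ^^ n) u) v = B u ((P ^^ n) v)"
  by (induction n arbitrary: u v) (auto simp: B_adjoint funpow_Suc_right funpow_swap1)

lemma B_orbit_isotropic: "B ((P ^^ r) a) ((P ^^ s) a) = 0"
proof -
  have "B ((P ^^ r) a) ((P ^^ s) a) = B ((P ^^ (s + r)) a) a"
    by (simp add: B_adjoint_funpow[symmetric] funpow_add)
  moreover have "B ((P ^^ (s + r)) a) a = - B ((P ^^ (s + r)) a) a"
    by (metis B_adjoint_funpow B_skew)
  ultimately show ?thesis by simp
qed

lemma aut_invariant_kernel: "aut_invariant B P {v. (P ^^ i) v = 0}"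
proof -
  have "g ` {v. (P ^^ i) v = 0} \<subseteq> {v. (P ^^ i) v = 0}" if "g \<in> Aut B P" for g
  proof -
    from that have "Vector_Spaces.linear (*s) (*s) g" "\<And>u. g (P u) = P (g u)"
      by (auto simp: Aut_def)
    then show ?thesis using funpow_commute[of g P i] by (auto simp: vec.linear_0)
  qed
  then show ?thesis
    by (simp add: aut_invariant_def vec.linear_subspace_kernel[OF linear_funpow])
qed

end

locale nilpotent_symplectic_self_adjoint = symplectic_self_adjoint B P
  for B :: "'k::field_char_0^'n \<Rightarrow> 'k^'n \<Rightarrow> 'k" and P +
  fixes k :: nat
  assumes funpow_nilpotent: "(P ^^ k) v = 0"
begin

lemma range_subset_kernel: "i \<le> k \<Longrightarrow> range (P ^^ (k - i)) \<subseteq> {v. (P ^^ i) v = 0}"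
  using funpow_le_apply(1)[of i k P] funpow_nilpotent by auto

definition transvection_map :: "'k^'n \<Rightarrow> 'k^'n \<Rightarrow> 'k^'n \<Rightarrow> 'k^'n" where
  "transvection_map a b v = (\<Sum>r<k. B ((P ^^ (k - Suc r)) a) v *s (P ^^ r) b)"

definition transvection :: "'k \<Rightarrow> 'k^'n \<Rightarrow> 'k^'n \<Rightarrow> 'k^'n" where
  "transvection c a v = v + c *s transvection_map a a v"

lemma transvection_map_add: "transvection_map a b (u + v) = transvection_map a b u + transvection_map a b v"
  unfolding transvection_map_def by (simp add: B_add_right vec.scale_left_distrib sum.distrib)

lemma transvection_map_scale: "transvection_map a b (c *s v) = c *s transvection_map a b v"
  unfolding transvection_map_def by (simp add: B_scale_right vec.scale_sum_right)

lemma transvection_map_add_left: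
  "transvection_map (a + a') b v = transvection_map a b v + transvection_map a' b v"
  unfolding transvection_map_def
  by (simp add: B_add_left vec.linear_add[OF linear_funpow] vec.scale_left_distrib sum.distrib)

lemma transvection_map_add_middle:
  "transvection_map a (b + b') v = transvection_map a b v + transvection_map a b' v"
  unfolding transvection_map_def
  by (simp add: vec.linear_add[OF linear_funpow] vec.scale_right_distrib sum.distrib)

lemma B_transvection_map_right:
  "B y (transvection_map a b v) = (\<Sum>r<k. B ((P ^^ (k - Suc r)) a) v * B y ((P ^^ r) b))"
  unfolding transvection_map_def by (simp add: B_sum_right B_scale_right)

lemma B_transvection_map_left:
  "B (transvection_map a b v) y = (\<Sum>r<k. B ((P ^^ (k - Suc r)) a) v * B ((P ^^ r) b) y)"
  unfolding transvection_map_def by (simp add: B_sum_left B_scale_left)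

lemma transvection_map_square: "transvection_map a a (transvection_map a a v) = 0"
  unfolding transvection_map_def[of a a "transvection_map a a v"]
  by (simp add: B_transvection_map_right B_orbit_isotropic)

lemma B_transvection_map_both: "B (transvection_map a a u) (transvection_map a a v) = 0"
  by (simp add: B_transvection_map_right B_transvection_map_left B_orbit_isotropic)

lemma transvection_map_skew: "B u (transvection_map a a v) + B (transvection_map a a u) v = 0"
proof -
  have "B (transvection_map a a u) v
      = (\<Sum>r<k. B ((P ^^ (k - Suc (k - Suc r))) a) u * B ((P ^^ (k - Suc r)) a) v)"
    unfolding B_transvection_map_left by (rule sum.nat_diff_reindex[symmetric])
  also have "\<dots> = (\<Sum>r<k. - (B ((P ^^ (k - Suc r)) a) v * B u ((P ^^ r) a)))"
  proof (rule sum.cong[OF refl])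
    fix r assume "r \<in> {..<k}"
    then have "k - Suc (k - Suc r) = r" by simp
    then show "B ((P ^^ (k - Suc (k - Suc r))) a) u * B ((P ^^ (k - Suc r)) a) v
             = - (B ((P ^^ (k - Suc r)) a) v * B u ((P ^^ r) a))"
      using B_skew[of u "(P ^^ r) a"] by simp
  qed
  finally show ?thesis unfolding B_transvection_map_right by (simp add: sum_negf)
qed

lemma transvection_map_commute: "transvection_map a b (P v) = P (transvection_map a b v)"
proof -
  define g where "g r = B ((P ^^ (k - r)) a) v *s (P ^^ r) b" for r
  have "P ((P ^^ (k - Suc r)) a) = (P ^^ (k - r)) a" if "r < k" for r
    using that by (metis Suc_diff_Suc comp_apply funpow.simps(2))
  then have "transvection_map a b (P v) = (\<Sum>r<k. g r)"
    unfolding transvection_map_def g_def by (intro sum.cong refl) (simp add: B_adjoint[symmetric])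
  also have "\<dots> = (\<Sum>r<Suc k. g r)"
    by (simp add: g_def funpow_nilpotent)
  also have "\<dots> = (\<Sum>r<k. g (Suc r))"
    by (subst sum.lessThan_Suc_shift) (simp add: g_def funpow_nilpotent B_zero_left)
  also have "\<dots> = P (transvection_map a b v)"
    unfolding transvection_map_def g_def
    by (simp add: vec.linear_sum[OF linear_P] vec.linear_scale[OF linear_P])
  finally show ?thesis .
qed

lemma transvection_inverse: "transvection (- c) a (transvection c a v) = v"
  unfolding transvection_def
  by (simp add: transvection_map_add transvection_map_scale transvection_map_square)

lemma transvection_in_Aut: "transvection c a \<in> Aut B P"
proof -
  have "Vector_Spaces.linear (*s) (*s) (transvection c a)"
    by (simp add: Vector_Spaces.linear_iff vec.vector_space_axioms transvection_def
        transvection_map_add transvection_map_scale vec.scale_right_distrib mult.commute)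
  moreover have "bij (transvection c a)"
    by (rule o_bij[where g = "transvection (- c) a"])
      (auto simp: fun_eq_iff transvection_inverse transvection_inverse[of "- c", simplified])
  moreover have "B (transvection c a u) (transvection c a v) = B u v" for u v
  proof -
    have "B (transvection c a u) (transvection c a v) = B u v
        + c * (B u (transvection_map a a v) + B (transvection_map a a u) v)
        + c * c * B (transvection_map a a u) (transvection_map a a v)"
      unfolding transvection_def
      by (simp add: B_add_left B_add_right B_scale_left B_scale_right algebra_simps)
    then show ?thesis by (simp add: transvection_map_skew B_transvection_map_both)
  qed
  moreover have "transvection c a (P u) = P (transvection c a u)" for u
    unfolding transvection_def
    by (simp add: transvection_map_commute vec.linear_add[OF linear_P] vec.linear_scale[OF linear_P])
  ultimately show ?thesis by (simp add: Aut_def)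
qed

lemma aut_invariant_transvection_map:
  assumes "aut_invariant B P W" "v \<in> W"
  shows "transvection_map a a v \<in> W"
proof -
  have "transvection 1 a v \<in> W"
    using assms transvection_in_Aut unfolding aut_invariant_def by blast
  then have "transvection 1 a v - v \<in> W"
    using assms by (simp add: aut_invariant_def vec.subspace_diff)
  then show ?thesis by (simp add: transvection_def)
qed

lemma aut_invariant_transvection_map_polarized:
  assumes "aut_invariant B P W" "v \<in> W"
  shows "transvection_map a b v + transvection_map b a v \<in> W"
proof -
  have "transvection_map a b v + transvection_map b a v
      = transvection_map (a + b) (a + b) v - transvection_map a a v - transvection_map b b v"
    by (simp add: transvection_map_add_left transvection_map_add_middle algebra_simps)
  then show ?thesis
    using assms aut_invariant_transvection_map[OF assms]
    by (simp add: aut_invariant_def vec.subspace_diff)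
qed

lemma transvection_map_leading_left:
  assumes W: "vec.subspace W" and IH: "range (P ^^ (k - d)) \<subseteq> W"
    and w: "(P ^^ i) w = 0" and "d < i" "i \<le> k"
  shows "transvection_map ((P ^^ (i - Suc d)) z) b w
       - B z ((P ^^ (i - 1)) w) *s (P ^^ (k - Suc d)) b \<in> W"
proof -
  define a where "a = (P ^^ (i - Suc d)) z"
  have B_a: "B ((P ^^ n) a) w = B z ((P ^^ (n + (i - Suc d))) w)" for n
    unfolding a_def by (metis B_adjoint_funpow comp_apply funpow_add)
  have "transvection_map a b w
      - B ((P ^^ (k - Suc (k - Suc d))) a) w *s (P ^^ (k - Suc d)) b \<in> W"
    unfolding transvection_map_def
  proof (rule sum_minus_term_in_subspace[OF W])
    fix r assume "r < k - Suc d"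
    then show "B ((P ^^ (k - Suc r)) a) w = 0"
      by (simp add: B_a funpow_eq_0_mono[OF w] B_zero_right)
  qed (use \<open>d < i\<close> \<open>i \<le> k\<close> funpow_in_range_subset[OF IH] in auto)
  moreover have "k - Suc (k - Suc d) + (i - Suc d) = i - 1"
    using \<open>d < i\<close> \<open>i \<le> k\<close> by simp
  ultimately show ?thesis
    by (simp add: B_a flip: a_def)
qed

lemma transvection_map_leading_right:
  assumes W: "vec.subspace W" and IH: "range (P ^^ (k - d)) \<subseteq> W"
    and w: "(P ^^ i) w = 0" and "d < i" "i \<le> k"
  shows "transvection_map b ((P ^^ (i - Suc d)) z) w
       - B ((P ^^ (i - 1)) b) w *s (P ^^ (k - Suc d)) z \<in> W"
proof -
  define a where "a = (P ^^ (i - Suc d)) z"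
  have P_a: "(P ^^ n) a = (P ^^ (n + (i - Suc d))) z" for n
    unfolding a_def by (simp add: funpow_add)
  have "transvection_map b a w
      - B ((P ^^ (k - Suc (k - i))) b) w *s (P ^^ (k - i)) a \<in> W"
    unfolding transvection_map_def
  proof (rule sum_minus_term_in_subspace[OF W])
    fix r assume "r < k - i"
    then show "B ((P ^^ (k - Suc r)) b) w = 0"
      by (simp add: B_adjoint_funpow funpow_eq_0_mono[OF w] B_zero_right)
  next
    fix r assume "k - i < r"
    then have "k - d \<le> r + (i - Suc d)"
      using \<open>d < i\<close> by linarith
    then show "(P ^^ r) a \<in> W"
      unfolding P_a by (rule funpow_in_range_subset[OF IH])
  qed (use \<open>d < i\<close> \<open>i \<le> k\<close> in auto)
  moreover have "k - Suc (k - i) = i - 1" "k - i + (i - Suc d) = k - Suc d"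
    using \<open>d < i\<close> \<open>i \<le> k\<close> by simp_all
  ultimately show ?thesis
    by (simp add: P_a flip: a_def)
qed

lemma aut_invariant_range_step:
  assumes W: "aut_invariant B P W"
    and w: "w \<in> W" "(P ^^ i) w = 0" and z: "B z ((P ^^ (i - 1)) w) \<noteq> 0"
    and "d < i" "i \<le> k" and IH: "range (P ^^ (k - d)) \<subseteq> W"
  shows "range (P ^^ (k - Suc d)) \<subseteq> W"
proof -
  have sub: "vec.subspace W"
    using W by (simp add: aut_invariant_def)
  define c where "c = B z ((P ^^ (i - 1)) w)"
  define a where "a = (P ^^ (i - Suc d)) z"
  define X where "X b = (P ^^ (k - Suc d)) b" for b
  \<comment> \<open>for b = z both terms equal c X z, so X z \<in> W, and then X b \<in> W for every b\<close>
  have leading_terms: "c *s X b + B ((P ^^ (i - 1)) b) w *s X z \<in> W" for b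
  proof -
    have "c *s X b + B ((P ^^ (i - 1)) b) w *s X z
        = (transvection_map a b w + transvection_map b a w)
          - (transvection_map a b w - c *s X b)
          - (transvection_map b a w - B ((P ^^ (i - 1)) b) w *s X z)"
      by (simp add: algebra_simps)
    also have "\<dots> \<in> W"
      unfolding a_def c_def X_def
      by (rule vec.subspace_diff[OF sub vec.subspace_diff[OF sub]]
          aut_invariant_transvection_map_polarized[OF W w(1)]
          transvection_map_leading_left[OF sub IH w(2) \<open>d < i\<close> \<open>i \<le> k\<close>]
          transvection_map_leading_right[OF sub IH w(2) \<open>d < i\<close> \<open>i \<le> k\<close>])+
    finally show ?thesis .
  qed
  have "c \<noteq> 0" "B ((P ^^ (i - 1)) z) w = c"
    using z by (simp_all add: c_def B_adjoint_funpow)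
  then have "(c + c) *s X z \<in> W"
    using leading_terms[of z] by (simp only: vec.scale_left_distrib)
  then have "X z \<in> W"
    by (rule subspace_scale_cancel[OF sub, rotated]) (use \<open>c \<noteq> 0\<close> in simp)
  show ?thesis
  proof clarify
    fix y
    have "c *s X y = (c *s X y + B ((P ^^ (i - 1)) y) w *s X z) - B ((P ^^ (i - 1)) y) w *s X z"
      by simp
    then have "c *s X y \<in> W"
      using leading_terms[of y] vec.subspace_scale[OF sub \<open>X z \<in> W\<close>]
      by (metis vec.subspace_diff[OF sub])
    then show "(P ^^ (k - Suc d)) y \<in> W"
      using subspace_scale_cancel[OF sub \<open>c \<noteq> 0\<close>] by (simp add: X_def)
  qed
qed

lemma aut_invariant_contains_range:
  assumes W: "aut_invariant B P W"
    and w: "w \<in> W" "(P ^^ i) w = 0" "(P ^^ (i - 1)) w \<noteq> 0" and "i \<le> k"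
  shows "range (P ^^ (k - i)) \<subseteq> W"
proof -
  obtain z where z: "B z ((P ^^ (i - 1)) w) \<noteq> 0"
    using B_nondegenerate B_skew w(3) by metis
  have "range (P ^^ (k - d)) \<subseteq> W" if "d \<le> i" for d
    using that
  proof (induction d)
    case 0
    then show ?case
      using W by (auto simp: aut_invariant_def funpow_nilpotent vec.subspace_0)
  next
    case (Suc d)
    then show ?case
      using aut_invariant_range_step[OF W w(1,2) z] \<open>i \<le> k\<close> by simp
  qed
  then show ?thesis by simp
qed

lemma aut_invariant_imp_kernel:
  assumes W: "aut_invariant B P W"
    and kernel_eq_range: "\<And>i. i \<le> k \<Longrightarrow> {v. (P ^^ i) v = 0} = range (P ^^ (k - i))"
  shows "\<exists>i\<le>k. W = {v. (P ^^ i) v = 0}"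
proof -
  obtain i where W_ker: "W \<subseteq> {v. (P ^^ i) v = 0}"
    and least: "\<And>j. j < i \<Longrightarrow> \<not> W \<subseteq> {v. (P ^^ j) v = 0}"
    using exists_least_iff[of "\<lambda>i. W \<subseteq> {v. (P ^^ i) v = 0}"] funpow_nilpotent by blast
  have "i \<le> k"
    using least[of k] funpow_nilpotent by force
  have "{v. (P ^^ i) v = 0} \<subseteq> W"
  proof (cases "i = 0")
    case True
    then show ?thesis
      using W by (auto simp: aut_invariant_def vec.subspace_0)
  next
    case False
    then obtain w where w: "w \<in> W" "(P ^^ (i - 1)) w \<noteq> 0"
      using least[of "i - 1"] by auto
    moreover have "(P ^^ i) w = 0"
      using W_ker w(1) by blast
    ultimately show ?thesis
      using aut_invariant_contains_range[OF W] kernel_eq_range[OF \<open>i \<le> k\<close>] \<open>i \<le> k\<close> by blast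
  qed
  then show ?thesis
    using W_ker \<open>i \<le> k\<close> by blast
qed

end

locale symplectic_jordan_blocks = symplectic_self_adjoint B P
  for B :: "'k::field_char_0^'n \<Rightarrow> 'k^'n \<Rightarrow> 'k" and P +
  fixes k m :: nat and x :: "nat \<Rightarrow> nat \<Rightarrow> 'k^'n"
  assumes basis_spans: "vec.span ((\<lambda>(j, i). x j i) ` ({..<m} \<times> {..<2*k})) = UNIV"
    and block_invariant: "\<And>j. j < m \<Longrightarrow> P ` vec.span (x j ` {..<2*k}) \<subseteq> vec.span (x j ` {..<2*k})"
    and blocks_orthogonal: "\<And>j j' u v. j < m \<Longrightarrow> j' < m \<Longrightarrow> j \<noteq> j' \<Longrightarrow>
      u \<in> vec.span (x j ` {..<2*k}) \<Longrightarrow> v \<in> vec.span (x j' ` {..<2*k}) \<Longrightarrow> B u v = 0"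
    and B_basis: "\<And>j i l. j < m \<Longrightarrow> i < 2*k \<Longrightarrow> l < 2*k \<Longrightarrow> B (x j i) (x j l) = Bstd k i l"
    and A_basis: "\<And>j i l. j < m \<Longrightarrow> i < 2*k \<Longrightarrow> l < 2*k \<Longrightarrow> B (P (x j i)) (x j l) = Astd k i l"
begin

lemma eq_if_B_basis_eq:
  assumes "\<And>j l. j < m \<Longrightarrow> l < 2*k \<Longrightarrow> B u (x j l) = B v (x j l)"
  shows "u = v"
proof -
  have "B (u - v) y = 0" for y
  proof (rule module_hom.eq_0_on_span[OF module_hom_B_right])
    show "y \<in> vec.span ((\<lambda>(j, i). x j i) ` ({..<m} \<times> {..<2*k}))"
      using basis_spans by simp
  qed (use assms in \<open>auto simp: B_diff_left\<close>)
  then show ?thesis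
    using B_nondegenerate[of "u - v"] by simp
qed

lemma basis_in_block: "l < 2*k \<Longrightarrow> x j l \<in> vec.span (x j ` {..<2*k})"
  by (rule vec.span_base) auto

lemma P_basis:
  assumes j: "j < m" and i: "i < 2*k"
  shows "P (x j i) = (if i < k then (if Suc i < k then x j (Suc i) else 0)
                      else if k < i then x j (i - 1) else 0)" (is "_ = ?next")
proof (rule eq_if_B_basis_eq)
  fix j' l assume j': "j' < m" and l: "l < 2*k"
  show "B (P (x j i)) (x j' l) = B ?next (x j' l)"
  proof (cases "j' = j")
    case True
    then show ?thesis
      using A_basis[OF j i l] i l j
      by (auto simp: B_basis B_zero_left Bstd_def Astd_def Jcell_def)
  next
    case False
    have "P (x j i) \<in> vec.span (x j ` {..<2*k})" "?next \<in> vec.span (x j ` {..<2*k})"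
      using block_invariant[OF j] basis_in_block[OF i] i
      by (auto intro: basis_in_block vec.span_zero)
    then show ?thesis
      using blocks_orthogonal[OF j j' \<open>j' \<noteq> j\<close>[symmetric]] basis_in_block[OF l] by simp
  qed
qed

lemma funpow_basis:
  assumes j: "j < m" and i: "i < 2*k"
  shows "(P ^^ n) (x j i) = (if i < k then (if i + n < k then x j (i + n) else 0)
                             else if k + n \<le> i then x j (i - n) else 0)"
proof (induction n)
  case 0
  then show ?case by simp
next
  case (Suc n)
  then show ?case
    using P_basis[OF j, of "i + n"] P_basis[OF j, of "i - n"] i vec.linear_0[OF linear_P]
    by auto
qed

sublocale nilpotent_symplectic_self_adjoint B P k
proof
  fix v
  show "(P ^^ k) v = 0"
  proof (rule vec.linear_eq_0_on_span[OF linear_funpow])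
    show "v \<in> vec.span ((\<lambda>(j, i). x j i) ` ({..<m} \<times> {..<2*k}))"
      using basis_spans by simp
  qed (auto simp: funpow_basis)
qed

lemma basis_eq_funpow_lower: "j < m \<Longrightarrow> n \<le> p \<Longrightarrow> p < k \<Longrightarrow> x j p = (P ^^ n) (x j (p - n))"
  by (simp add: funpow_basis)

lemma basis_eq_funpow_upper: "j < m \<Longrightarrow> p + n < k \<Longrightarrow> x j (k + p) = (P ^^ n) (x j (k + p + n))"
  by (simp add: funpow_basis)

lemma B_basis_expansion_term:
  assumes "j < m" "j' < m" "p < k" "l < 2*k"
  shows "B (B v (x j (k + p)) *s x j p - B v (x j p) *s x j (k + p)) (x j' l)
       = (if p = (if l < k then l else l - k) then if j = j' then B v (x j' l) else 0 else 0)"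
proof (cases "j = j'")
  case True
  then show ?thesis
    using assms B_skew[of v "x j' l"]
    by (auto simp: B_diff_left B_scale_left B_basis Bstd_def)
next
  case False
  then show ?thesis
    using assms blocks_orthogonal[OF assms(1,2) False basis_in_block basis_in_block]
    by (simp add: B_diff_left B_scale_left)
qed

lemma basis_expansion:
  "v = (\<Sum>j<m. \<Sum>p<k. B v (x j (k + p)) *s x j p - B v (x j p) *s x j (k + p))"
proof (rule eq_if_B_basis_eq)
  fix j' l assume "j' < m" "l < 2*k"
  moreover have "l - k < k"
    using \<open>l < 2*k\<close> by simp
  ultimately show "B v (x j' l)
      = B (\<Sum>j<m. \<Sum>p<k. B v (x j (k + p)) *s x j p - B v (x j p) *s x j (k + p)) (x j' l)"
    by (simp add: B_sum_left B_basis_expansion_term)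
qed

lemma kernel_subset_range:
  assumes "(P ^^ i) v = 0" "i \<le> k"
  shows "v \<in> range (P ^^ (k - i))"
proof -
  have orthogonal: "B v ((P ^^ i) y) = 0" for y
    using assms(1) by (simp add: B_adjoint_funpow[symmetric] B_zero_left)
  have sub: "vec.subspace (range (P ^^ (k - i)))"
    by (rule vec.linear_subspace_image[OF linear_funpow vec.subspace_UNIV])
  have "(\<Sum>j<m. \<Sum>p<k. B v (x j (k + p)) *s x j p - B v (x j p) *s x j (k + p))
      \<in> range (P ^^ (k - i))"
  proof (intro vec.subspace_sum[OF sub] vec.subspace_diff[OF sub])
    fix j p assume "j \<in> {..<m}" "p \<in> {..<k}"
    then have j: "j < m" and p: "p < k" by auto
    show "B v (x j (k + p)) *s x j p \<in> range (P ^^ (k - i))"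
    proof (cases "k - i \<le> p")
      case True
      then show ?thesis
        using basis_eq_funpow_lower[OF j True p] vec.subspace_scale[OF sub] by (metis rangeI)
    next
      case False
      then show ?thesis
        using basis_eq_funpow_upper[OF j, of p i] orthogonal vec.subspace_0[OF sub] by simp
    qed
    show "B v (x j p) *s x j (k + p) \<in> range (P ^^ (k - i))"
    proof (cases "p < i")
      case True
      then have "p + (k - i) < k"
        using \<open>i \<le> k\<close> by linarith
      then show ?thesis
        using basis_eq_funpow_upper[OF j] vec.subspace_scale[OF sub] by (metis rangeI)
    next
      case False
      then show ?thesis
        using basis_eq_funpow_lower[OF j _ p, of i] orthogonal vec.subspace_0[OF sub] by simp
    qed
  qed
  then show ?thesis
    using basis_expansion[of v] by simp
qed

lemma kernel_eq_range: "i \<le> k \<Longrightarrow> {v. (P ^^ i) v = 0} = range (P ^^ (k - i))"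
  using kernel_subset_range range_subset_kernel by blast

end

theorem aut_invariant_subspaces_jordan_blocks:
  fixes B :: "'k::field_char_0^'n \<Rightarrow> 'k^'n \<Rightarrow> 'k" and P :: "'k^'n \<Rightarrow> 'k^'n"
  assumes "symplectic_form B" "lin_op P" "self_adjoint B P" "jordan_blocks_same_height B P k"
  shows "(\<forall>i\<le>k. {v. (P ^^ i) v = 0} = range (P ^^ (k - i))) \<and>
         (\<forall>W. aut_invariant B P W \<longleftrightarrow> (\<exists>i\<le>k. W = {v. (P ^^ i) v = 0}))"
proof -
  from assms(4) obtain m and x :: "nat \<Rightarrow> nat \<Rightarrow> 'k^'n" where blocks:
    "vec.span ((\<lambda>(j, i). x j i) ` ({..<m} \<times> {..<2*k})) = UNIV"
    "\<forall>j<m. P ` vec.span (x j ` {..<2*k}) \<subseteq> vec.span (x j ` {..<2*k})"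
    "\<forall>j<m. \<forall>j'<m. j \<noteq> j' \<longrightarrow>
       (\<forall>u\<in>vec.span (x j ` {..<2*k}). \<forall>v\<in>vec.span (x j' ` {..<2*k}). B u v = 0)"
    "\<forall>j<m. \<forall>i<2*k. \<forall>l<2*k. B (x j i) (x j l) = Bstd k i l \<and> B (P (x j i)) (x j l) = Astd k i l"
    unfolding jordan_blocks_same_height_def by (elim exE conjE) (rule that; assumption)
  interpret symplectic_jordan_blocks B P k m x
  proof unfold_locales
    show "symplectic_form B" "lin_op P" "self_adjoint B P" by fact+
  qed (use blocks in fast)+
  have "aut_invariant B P W \<longleftrightarrow> (\<exists>i\<le>k. W = {v. (P ^^ i) v = 0})" for W
    using aut_invariant_imp_kernel[OF _ kernel_eq_range] aut_invariant_kernel by blast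
  then show ?thesis
    using kernel_eq_range by simp
qed

theorem corollary1:
  shows "(\<forall>(B :: real^'n \<Rightarrow> real^'n \<Rightarrow> real) (P :: real^'n \<Rightarrow> real^'n) (k::nat).
            symplectic_form B \<and> lin_op P \<and> nilpotent_op P \<and> self_adjoint B P \<and>
            jordan_blocks_same_height B P k \<longrightarrow>
            (\<forall>i\<le>k. {v. (P ^^ i) v = 0} = range (P ^^ (k - i))) \<and>
            (\<forall>W. aut_invariant B P W \<longleftrightarrow> (\<exists>i\<le>k. W = {v. (P ^^ i) v = 0})))
       \<and>
         (\<forall>(B :: complex^'n \<Rightarrow> complex^'n \<Rightarrow> complex) (P :: complex^'n \<Rightarrow> complex^'n) (k::nat).
            symplectic_form B \<and> lin_op P \<and> nilpotent_op P \<and> self_adjoint B P \<and>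
            jordan_blocks_same_height B P k \<longrightarrow>
            (\<forall>i\<le>k. {v. (P ^^ i) v = 0} = range (P ^^ (k - i))) \<and>
            (\<forall>W. aut_invariant B P W \<longleftrightarrow> (\<exists>i\<le>k. W = {v. (P ^^ i) v = 0})))"
  by (rule conjI; intro allI impI; elim conjE; rule aut_invariant_subspaces_jordan_blocks)

end
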